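(* Let $\mu$ be a Borel probability measure on $\mathbb{R}^d$ and let $D\ge 0$. If $\mu$ satisfies $\mathrm{GCBS}(D)$, then $\mu$ satisfies $\mathrm{GCB}(D)$, with the same constant $D$.
   Context: $\|\cdot\|$ is the Euclidean norm on $\mathbb{R}^d$, $\mathrm{lip}(f)=\sup_{x\neq y}|f(x)-f(y)|/\|x-y\|$, and $\mu(f)=\int f\,d\mu$. $\mathrm{GCBS}(D)$ (smooth Gaussian concentration bound): $\log\mu\left(e^{f-\mu(f)}\right)\le D\,\mathrm{lip}(f)^2$ for all infinitely differentiable compactly supported $f:\mathbb{R}^d\to\mathbb{R}$. $\mathrm{GCB}(D)$ (Gaussian concentration bound): $\log\mu\left(e^{f-\mu(f)}\right)\le D\,\mathrm{lip}(f)^2$ for all Lipschitz functions $f:\mathbb{R}^d\to\mathbb{R}$ (in particular such $f$ are $\mu$-integrable). *)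

theory Defs
  imports "HOL-Probability.Probability"
begin

text \<open>\<open>C\<^sup>n\<close> functions: the second equation asks every directional derivative
  \<open>x \<mapsto> Df(x) v\<close> of \<open>f\<close> to be \<open>C\<^sup>n\<close>; in finite dimension this covers all partial derivatives.\<close>

fun cont_diff :: "nat \<Rightarrow> ('a::euclidean_space \<Rightarrow> real) \<Rightarrow> bool" where
  "cont_diff 0 f \<longleftrightarrow> continuous_on UNIV f"
| "cont_diff (Suc n) f \<longleftrightarrow>
     (\<forall>x. f differentiable (at x)) \<and> (\<forall>v. cont_diff n (\<lambda>x. frechet_derivative f (at x) v))"

definition smooth :: "('a::euclidean_space \<Rightarrow> real) \<Rightarrow> bool" where
  "smooth f \<longleftrightarrow> (\<forall>n. cont_diff n f)"

definition compactly_supported :: "('a::euclidean_space \<Rightarrow> real) \<Rightarrow> bool" where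
  "compactly_supported f \<longleftrightarrow> compact (closure (support_on UNIV f))"

definition lipschitz :: "('a::euclidean_space \<Rightarrow> real) \<Rightarrow> bool" where
  "lipschitz f \<longleftrightarrow> (\<exists>L. L-lipschitz_on UNIV f)"

text \<open>The supremum is taken in the reals, so \<open>lip f\<close> is meaningful only for Lipschitz \<open>f\<close>.
  Below it is applied only to such functions (smooth compactly supported functions are Lipschitz).\<close>

definition lip :: "('a::euclidean_space \<Rightarrow> real) \<Rightarrow> real" where
  "lip f = (SUP (x, y) \<in> {(x, y). x \<noteq> y}. \<bar>f x - f y\<bar> / norm (x - y))"

text \<open>In \<open>GCBS\<close> both integrands are bounded and continuous, hence integrable for every Borel
  probability measure.\<close>

definition GCBS :: "('a::euclidean_space) measure \<Rightarrow> real \<Rightarrow> bool" where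
  "GCBS \<mu> D \<longleftrightarrow>
     (\<forall>f. smooth f \<and> compactly_supported f \<longrightarrow>
        ln (\<integral>x. exp (f x - (\<integral>y. f y \<partial>\<mu>)) \<partial>\<mu>) \<le> D * (lip f)\<^sup>2)"

text \<open>For general Lipschitz functions integrability is part of the claim. It has to be stated
  explicitly, since the Bochner integral of a non-integrable function is \<open>0\<close> and \<open>ln 0 = 0\<close>:
  finiteness of the exponential moment would otherwise be lost.\<close>

definition GCB :: "('a::euclidean_space) measure \<Rightarrow> real \<Rightarrow> bool" where
  "GCB \<mu> D \<longleftrightarrow>
     (\<forall>f. lipschitz f \<longrightarrow>
        integrable \<mu> f \<and>
        integrable \<mu> (\<lambda>x. exp (f x - (\<integral>y. f y \<partial>\<mu>))) \<and>
        ln (\<integral>x. exp (f x - (\<integral>y. f y \<partial>\<mu>)) \<partial>\<mu>) \<le> D * (lip f)\<^sup>2)"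

end

theory Submission
  imports Defs
begin

text \<open>
  A Lipschitz function \<open>f\<close> with \<open>f 0 = 0\<close> and constant \<open>L\<close> is a pointwise limit of smooth compactly
  supported functions \<open>F\<^sub>n\<close> that are \<open>L\<close>-Lipschitz with the same \<open>L\<close> and satisfy
  \<open>\<bar>F\<^sub>n x\<bar> \<le> L * (norm x + 1)\<close> (\<open>lipschitz_approximation\<close>). They are obtained by clamping \<open>f\<close> between two
  Lipschitz cones, which gives compact support, and mollifying; neither operation increases the
  Lipschitz constant. This is why the constant \<open>D\<close> survives unchanged.

  If the norm is \<open>\<mu>\<close>-integrable, the means \<open>\<mu>(F\<^sub>n)\<close> converge to \<open>\<mu>(f)\<close> by dominated convergence.
  The functions \<open>exp(F\<^sub>n - \<mu>(F\<^sub>n))\<close> then converge pointwise to \<open>exp(f - \<mu>(f))\<close>, and their integrals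
  are at most \<open>exp(D * L\<^sup>2)\<close>, so Fatou's lemma gives both the integrability of the limit and the
  bound (\<open>GCBS_imp_GCB\<close>).

  Integrability of the norm must itself be extracted from the bound for smooth functions
  (\<open>GCBS_imp_integrable_norm\<close>). The difficulty is that the bound controls only centred functions;
  applying it to the negatives of the approximations of the norm prevents their means from
  escaping to infinity.
\<close>

section \<open>Calculus of \<open>C\<^sup>n\<close> functions\<close>

text \<open>The recursion of \<^const>\<open>cont_diff\<close> speaks about \<^const>\<open>frechet_derivative\<close>, which is
  awkward to compute; this rule accepts any derivative that the differentiation rules produce.\<close>

lemma cont_diff_SucI:
  assumes "\<And>x. (f has_derivative f' x) (at x)" "\<And>v. cont_diff n (\<lambda>x. f' x v)"
  shows "cont_diff (Suc n) f"
proof -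
  have "frechet_derivative f (at x) = f' x" for x
    using frechet_derivative_at[OF assms(1)] by simp
  then show ?thesis
    using assms by (auto simp: differentiable_def)
qed

lemma cont_diff_has_derivative:
  "cont_diff (Suc n) f \<Longrightarrow> (f has_derivative frechet_derivative f (at x)) (at x)"
  by (simp add: frechet_derivative_works)

lemma cont_diff_imp_continuous: "cont_diff n f \<Longrightarrow> continuous_on UNIV f"
  by (cases n) (auto intro!: differentiable_imp_continuous_on simp: differentiable_on_def)

lemma cont_diff_Suc_imp: "cont_diff (Suc n) f \<Longrightarrow> cont_diff n f"
proof (induction n arbitrary: f)
  case 0
  then show ?case
    by (simp add: cont_diff_imp_continuous[OF 0])
qed simp

lemma cont_diff_const: "cont_diff n (\<lambda>x. c)"
proof (induction n arbitrary: c)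
  case (Suc n)
  show ?case by (rule cont_diff_SucI[where f' = "\<lambda>x v. 0"]) (auto intro: Suc)
qed simp

lemma cont_diff_add: "cont_diff n f \<Longrightarrow> cont_diff n g \<Longrightarrow> cont_diff n (\<lambda>x. f x + g x)"
proof (induction n arbitrary: f g)
  case (Suc n)
  show ?case
    by (rule cont_diff_SucI[OF has_derivative_add[OF Suc.prems[THEN cont_diff_has_derivative]]])
       (use Suc in auto)
qed (auto intro!: continuous_intros)

lemma cont_diff_mult: "cont_diff n f \<Longrightarrow> cont_diff n g \<Longrightarrow> cont_diff n (\<lambda>x. f x * g x)"
proof (induction n arbitrary: f g)
  case (Suc n)
  show ?case
  proof (rule cont_diff_SucI[OF has_derivative_mult[OF Suc.prems[THEN cont_diff_has_derivative]]])
    fix v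
    show "cont_diff n (\<lambda>x. f x * frechet_derivative g (at x) v + frechet_derivative f (at x) v * g x)"
      using Suc.prems Suc.prems[THEN cont_diff_Suc_imp]
      by (intro cont_diff_add Suc.IH) auto
  qed
qed (auto intro!: continuous_intros)

lemma cont_diff_inner_left: "cont_diff n (\<lambda>x. x \<bullet> v)"
proof (cases n)
  case (Suc m)
  have "cont_diff (Suc m) (\<lambda>x. x \<bullet> v)"
    by (rule cont_diff_SucI[where f' = "\<lambda>x w. w \<bullet> v"])
       (auto intro!: derivative_eq_intros cont_diff_const)
  then show ?thesis by (simp only: Suc)
qed (auto intro!: continuous_intros)

section \<open>Smooth mollifiers\<close>

text \<open>The classical \<open>exp (- 1 / t)\<close> on the positive half-line, extended by zero, has derivatives of
  the form \<open>P (1 / t) exp (- 1 / t)\<close>. Allowing every polynomial \<open>P\<close> from the start gives a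
  family that is closed under differentiation, so smoothness becomes an induction over one
  statement.\<close>

definition flat :: "real poly \<Rightarrow> real \<Rightarrow> real" where
  "flat p t = (if t > 0 then poly p (1 / t) * exp (- (1 / t)) else 0)"

lemma poly_times_exp_neg_tendsto_0: "((\<lambda>s::real. poly p s * exp (- s)) \<longlongrightarrow> 0) at_top"
proof -
  have "((\<lambda>s::real. \<Sum>i\<le>degree p. coeff p i * (s ^ i / exp s)) \<longlongrightarrow> (\<Sum>i\<le>degree p. coeff p i * 0)) at_top"
    by (intro tendsto_intros tendsto_power_div_exp_0)
  then show ?thesis
    by (simp add: poly_altdef sum_distrib_right exp_minus divide_inverse mult.assoc)
qed

text \<open>With \<open>s = 1 / t\<close> one has \<open>ds/dt = - s\<^sup>2\<close>, so the derivative of \<open>P(s) exp(- s)\<close> with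
  respect to \<open>t\<close> is \<open>s\<^sup>2 (P(s) - P'(s)) exp(- s)\<close>. At \<open>t = 0\<close> the right difference quotient is
  \<open>s P(s) exp(- s)\<close> for \<open>s \<rightarrow> \<infinity>\<close>, and the exponential wins.\<close>

lemma DERIV_flat: "(flat p has_field_derivative flat (monom 1 2 * (p - pderiv p)) t) (at t)"
proof (cases t "0::real" rule: linorder_cases)
  case less
  have "((\<lambda>t. 0) has_field_derivative 0) (at t)" by simp
  moreover have "\<forall>\<^sub>F s in nhds t. flat p s = 0"
    using eventually_nhds_in_open[of "{..<0}" t] less by (auto simp: flat_def elim!: eventually_mono)
  ultimately show ?thesis
    using less by (subst DERIV_cong_ev) (auto simp: flat_def)
next
  case greater
  have "((\<lambda>t. poly p (1 / t) * exp (- (1 / t))) has_field_derivative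
      flat (monom 1 2 * (p - pderiv p)) t) (at t)"
    using greater
    by (auto intro!: derivative_eq_intros DERIV_chain2[OF poly_DERIV]
             simp: flat_def poly_monom field_simps power2_eq_square)
  moreover have "\<forall>\<^sub>F s in nhds t. flat p s = poly p (1 / s) * exp (- (1 / s))"
    using eventually_nhds_in_open[of "{0<..}" t] greater by (auto simp: flat_def elim!: eventually_mono)
  ultimately show ?thesis
    by (subst DERIV_cong_ev) auto
next
  case equal
  have "((\<lambda>t. flat p t / t) \<longlongrightarrow> 0) (at_left 0)"
    by (rule tendsto_eventually) (auto simp: flat_def eventually_at_left_field intro: exI[of _ "-1"])
  moreover have "((\<lambda>t. flat p t / t) \<longlongrightarrow> 0) (at_right 0)"
    unfolding filterlim_at_right_to_top
  proof (rule Lim_transform_eventually)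
    show "((\<lambda>s::real. poly (pCons 0 p) s * exp (- s)) \<longlongrightarrow> 0) at_top"
      by (rule poly_times_exp_neg_tendsto_0)
    show "\<forall>\<^sub>F s in at_top. poly (pCons 0 p) s * exp (- s) = flat p (inverse s) / inverse s"
      using eventually_gt_at_top[of 0] by eventually_elim (simp add: flat_def field_simps)
  qed
  ultimately have "((\<lambda>t. flat p t / t) \<longlongrightarrow> 0) (at 0)"
    by (rule filterlim_split_at)
  then show ?thesis
    using equal by (simp add: has_field_derivative_iff flat_def)
qed

text \<open>Using \<open>x \<bullet> x\<close> instead of \<open>norm x\<close> avoids the singularity of the norm at the origin: each
  directional derivative is again of this form, times a linear function of \<open>x\<close>.\<close>

lemma cont_diff_flat_radial: "cont_diff n (\<lambda>x::'a::euclidean_space. flat p (c - x \<bullet> x))"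
proof (induction n arbitrary: p)
  case 0
  have "continuous_on UNIV (flat p)"
    using DERIV_flat by (blast intro: DERIV_continuous_on)
  then show ?case
    by (auto intro!: continuous_intros continuous_on_compose2[of UNIV "flat p"])
next
  case (Suc n)
  let ?q = "monom 1 2 * (p - pderiv p)"
  have "((\<lambda>x::'a. flat p (c - x \<bullet> x)) has_derivative
      (\<lambda>v. flat ?q (c - x \<bullet> x) * (- 2 * (x \<bullet> v)))) (at x)" for x
    by (rule has_derivative_eq_rhs[OF has_derivative_compose[OF _ DERIV_flat[unfolded has_field_derivative_def]]])
       (auto intro!: derivative_eq_intros simp: inner_commute)
  then show ?case
    by (rule cont_diff_SucI) (intro cont_diff_mult cont_diff_const cont_diff_inner_left Suc)
qed

lemma ex_mollifier:
  assumes "r > 0"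
  obtains \<phi> :: "'a::euclidean_space \<Rightarrow> real" where
    "smooth \<phi>" "\<And>x. \<phi> x \<ge> 0" "\<And>x. norm x \<ge> r \<Longrightarrow> \<phi> x = 0"
    "integrable lborel \<phi>" "(\<integral>x. \<phi> x \<partial>lborel) = 1"
proof -
  define b :: "'a \<Rightarrow> real" where "b x = flat 1 (r\<^sup>2 - x \<bullet> x)" for x
  have smooth: "cont_diff n b" for n
    unfolding b_def by (rule cont_diff_flat_radial)
  have nonneg: "b x \<ge> 0" for x
    by (simp add: b_def flat_def)
  have pos: "b x > 0 \<longleftrightarrow> norm x < r" for x
  proof -
    have "r\<^sup>2 \<le> x \<bullet> x \<longleftrightarrow> r \<le> norm x"
      using assms by (simp add: power_mono_iff flip: power2_norm_eq_inner)
    then show ?thesis by (auto simp: b_def flat_def)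
  qed
  have zero: "b x = 0" if "norm x \<ge> r" for x
    using pos[of x] nonneg[of x] that by linarith
  have "integrable lborel (\<lambda>x. indicator (cball 0 r) x *\<^sub>R b x)"
    using cont_diff_imp_continuous[OF smooth[of 0]]
    by (intro borel_integrable_compact) (auto intro: continuous_on_subset)
  also have "(\<lambda>x. indicator (cball 0 r) x *\<^sub>R b x) = b"
    by (auto simp: fun_eq_iff indicator_def zero)
  finally have int: "integrable lborel b" .
  have "(\<integral>x. b x \<partial>lborel) \<noteq> 0"
  proof
    assume "(\<integral>x. b x \<partial>lborel) = 0"
    then have "AE x in lborel. b x = 0"
      using integral_nonneg_eq_0_iff_AE[OF int] nonneg by simp
    then have "AE x in lborel. x \<notin> ball (0::'a) r"
      by (rule eventually_mono) (use pos in \<open>auto simp: less_le\<close>)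
    then have "ball (0::'a) r \<in> null_sets lborel"
      by (subst (asm) AE_iff_null_sets[symmetric]) auto
    then show False
      using assms open_not_negligible[of "ball (0::'a) r"]
      by (auto simp: negligible_iff_null_sets null_sets_completionI)
  qed
  moreover have "(\<integral>x. b x \<partial>lborel) \<ge> 0"
    using nonneg by simp
  ultimately have c: "(\<integral>x. b x \<partial>lborel) > 0" by simp
  show thesis
    by (rule that[of "\<lambda>x. inverse (\<integral>x. b x \<partial>lborel) * b x"])
       (use c nonneg zero int smooth in \<open>auto simp: smooth_def intro!: cont_diff_mult cont_diff_const\<close>)
qed

section \<open>Smoothing by convolution\<close>

text \<open>Only the smooth factor depends on \<open>x\<close>, so a derivative in \<open>x\<close> passes under the integral and
  falls on \<open>\<phi>\<close>, while \<open>g\<close> merely has to be continuous. The integral over a box serves the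
  case where \<open>g\<close> vanishes outside that box.\<close>

lemma cont_diff_convolution:
  fixes g \<phi> :: "'a::euclidean_space \<Rightarrow> real"
  assumes g: "continuous_on UNIV g"
  shows "cont_diff n \<phi> \<Longrightarrow> cont_diff n (\<lambda>x. integral (cbox a b) (\<lambda>y. g y * \<phi> (x - y)))"
proof (induction n arbitrary: \<phi>)
  case 0
  then have "continuous_on (UNIV \<times> cbox a b) (\<lambda>(x, y). g y * \<phi> (x - y))"
    by (auto simp: split_beta intro!: continuous_intros continuous_on_compose2[OF g]
        continuous_on_compose2[of UNIV \<phi>])
  then show ?case
    by (auto intro: integral_continuous_on_param)
next
  case (Suc n)
  define D where "D x = frechet_derivative \<phi> (at x)" for x
  have D: "(\<phi> has_derivative D x) (at x)" for x
    unfolding D_def by (rule cont_diff_has_derivative[OF Suc.prems])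
  have DC: "cont_diff n (\<lambda>x. D x v)" for v
    using Suc.prems by (simp add: D_def)
  \<comment> \<open>Continuity of the derivative in operator norm can be checked on basis vectors, as the dimension is finite.\<close>
  define F where "F x y = Blinfun (\<lambda>v. g y * D (x - y) v)" for x y
  have F: "blinfun_apply (F x y) = (\<lambda>v. g y * D (x - y) v)" for x y
    unfolding F_def
    by (intro bounded_linear_Blinfun_apply bounded_linear_const_mult has_derivative_bounded_linear[OF D])
  have contD: "continuous_on UNIV (\<lambda>x. D x v)" for v
    using DC cont_diff_imp_continuous by blast
  have contF: "continuous_on (UNIV \<times> cbox a b) (\<lambda>(x, y). F x y)"
    by (rule continuous_on_blinfun_componentwise)
       (auto simp: split_beta F intro!: continuous_intros continuous_on_compose2[OF g]
        continuous_on_compose2[OF contD])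
  have intF: "F x integrable_on cbox a b" for x
  proof (rule integrable_continuous)
    have "continuous_on (cbox a b) (\<lambda>y. case (x, y) of (x, y) \<Rightarrow> F x y)"
      by (rule continuous_on_compose2[OF contF continuous_on_Pair[OF continuous_on_const continuous_on_id]])
         auto
    then show "continuous_on (cbox a b) (F x)" by simp
  qed
  have "((\<lambda>x. integral (cbox a b) (\<lambda>y. g y * \<phi> (x - y))) has_derivative
      blinfun_apply (integral (cbox a b) (F x))) (at x)" for x
  proof (rule leibniz_rule[where U = UNIV])
    show "((\<lambda>x. g y * \<phi> (x - y)) has_derivative blinfun_apply (F x y)) (at x)" for x y
      unfolding F by (rule has_derivative_eq_rhs[OF has_derivative_mult_right[OF has_derivative_compose[OF _ D]]])
       (auto intro!: derivative_eq_intros)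
    show "(\<lambda>y. g y * \<phi> (x - y)) integrable_on cbox a b" for x
      by (intro integrable_continuous continuous_intros continuous_on_compose2[OF g]
          continuous_on_compose2[OF cont_diff_imp_continuous[OF Suc.prems]]) auto
  qed (use contF in auto)
  then show ?case
  proof (rule cont_diff_SucI)
    fix v
    have "blinfun_apply (integral (cbox a b) (F x)) v = integral (cbox a b) (\<lambda>y. g y * D (x - y) v)" for x
      using integral_linear[OF intF blinfun.bounded_linear_left, of v x] by (simp add: o_def F)
    then show "cont_diff n (\<lambda>x. blinfun_apply (integral (cbox a b) (F x)) v)"
      using Suc.IH[OF DC] by simp
  qed
qed

section \<open>Lipschitz constants\<close>

lemma lip_le:
  fixes f :: "'a::euclidean_space \<Rightarrow> real"
  assumes "L-lipschitz_on UNIV f"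
  shows "lip f \<le> L"
  unfolding lip_def
proof (rule cSUP_least)
  obtain b :: 'a where "b \<in> Basis" using nonempty_Basis by blast
  then have "(b, 0) \<in> {(x, y). x \<noteq> y}" by auto
  then show "{(x::'a, y). x \<noteq> y} \<noteq> {}" by blast
qed (use lipschitz_on_normD[OF assms] in \<open>auto simp: divide_le_eq\<close>)

lemma lipschitz_on_lip:
  fixes f :: "'a::euclidean_space \<Rightarrow> real"
  assumes "lipschitz f"
  shows "(lip f)-lipschitz_on UNIV f"
proof -
  obtain L where L: "L-lipschitz_on UNIV f"
    using assms by (auto simp: lipschitz_def)
  have bdd: "bdd_above ((\<lambda>(x, y). \<bar>f x - f y\<bar> / norm (x - y)) ` {(x, y). x \<noteq> y})"
    using lipschitz_on_normD[OF L] by (auto intro!: bdd_aboveI[of _ L] simp: divide_le_eq)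
  then have slope: "\<bar>f x - f y\<bar> / norm (x - y) \<le> lip f" if "x \<noteq> y" for x y
    unfolding lip_def using cSUP_upper[OF _ bdd, of "(x, y)"] that by simp
  obtain b :: 'a where "b \<in> Basis" using nonempty_Basis by blast
  then have "0 \<le> lip f"
    using slope[of b 0] by (intro order_trans[OF _ slope[of b 0]]) auto
  moreover have "\<bar>f x - f y\<bar> \<le> lip f * norm (x - y)" for x y
    using slope[of x y] by (cases "x = y") (auto simp: divide_le_eq)
  ultimately show ?thesis
    by (intro lipschitz_onI) (auto simp: dist_norm)
qed

lemma lip_nonneg: "lipschitz f \<Longrightarrow> 0 \<le> lip f"
  by (rule lipschitz_on_nonneg[OF lipschitz_on_lip])

lemma lipschitz_on_max:
  fixes f g :: "'a::metric_space \<Rightarrow> real"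
  assumes "L-lipschitz_on X f" "L-lipschitz_on X g"
  shows "L-lipschitz_on X (\<lambda>x. max (f x) (g x))"
proof (rule lipschitz_onI)
  fix x y assume "x \<in> X" "y \<in> X"
  then show "dist (max (f x) (g x)) (max (f y) (g y)) \<le> L * dist x y"
    using assms[THEN lipschitz_onD, of x y] by (auto simp: dist_real_def max_def abs_if split: if_splits)
qed (rule lipschitz_on_nonneg[OF assms(1)])

lemma lipschitz_on_min:
  fixes f g :: "'a::metric_space \<Rightarrow> real"
  assumes "L-lipschitz_on X f" "L-lipschitz_on X g"
  shows "L-lipschitz_on X (\<lambda>x. min (f x) (g x))"
  using lipschitz_on_max[of L X "\<lambda>x. - f x" "\<lambda>x. - g x"] assms
  by (simp flip: minus_min_eq_max)

lemma lipschitz_on_norm: "1-lipschitz_on X norm"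
  by (rule lipschitz_onI) (auto simp: dist_norm norm_triangle_ineq3)

section \<open>Approximation by smooth compactly supported functions\<close>

lemma lborel_integral_reflect:
  fixes h :: "'a::euclidean_space \<Rightarrow> real"
  assumes [measurable]: "h \<in> borel_measurable borel"
  shows "(\<integral>t. h (x - t) \<partial>lborel) = (\<integral>y. h y \<partial>lborel)"
proof -
  have "(lborel :: 'a measure) = distr lborel borel (\<lambda>t. x - t)"
    using lborel_affine[of "-1" x] by (simp add: density_1)
  then have "(\<integral>y. h y \<partial>lborel) = (\<integral>y. h y \<partial>distr lborel borel (\<lambda>t. x - t))"
    by simp
  also have "\<dots> = (\<integral>t. h (x - t) \<partial>lborel)"
    by (rule integral_distr) auto
  finally show ?thesis by simp
qed

text \<open>The two forms of the convolution do different work. As \<open>\<integral> \<phi>(t) g(x - t) dt\<close> it is an average of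
  translates of \<open>g\<close> with total weight 1, so it keeps the Lipschitz constant exactly and moves
  values by at most \<open>L * r\<close>. As \<open>\<integral> g(y) \<phi>(x - y) dy\<close> it is smooth.\<close>

lemma lipschitz_mollification:
  fixes g :: "'a::euclidean_space \<Rightarrow> real"
  assumes L: "L-lipschitz_on UNIV g" and supp: "\<And>x. norm x \<ge> R \<Longrightarrow> g x = 0" and "r > 0"
  obtains h where "smooth h" "\<And>x. norm x \<ge> R + r \<Longrightarrow> h x = 0"
    "L-lipschitz_on UNIV h" "\<And>x. \<bar>h x - g x\<bar> \<le> L * r"
proof -
  obtain \<phi> :: "'a \<Rightarrow> real" where \<phi>: "smooth \<phi>" "\<And>x. \<phi> x \<ge> 0" "\<And>x. norm x \<ge> r \<Longrightarrow> \<phi> x = 0"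
    "integrable lborel \<phi>" "(\<integral>x. \<phi> x \<partial>lborel) = 1"
    using ex_mollifier[OF \<open>r > 0\<close>] by blast
  have Lge: "L \<ge> 0" by (rule lipschitz_on_nonneg[OF L])
  have contg: "continuous_on UNIV g" by (rule lipschitz_on_continuous_on[OF L])
  have cont\<phi>: "continuous_on UNIV \<phi>" using \<phi>(1) cont_diff_imp_continuous by (auto simp: smooth_def)
  note [measurable] = borel_measurable_continuous_onI[OF contg] borel_measurable_continuous_onI[OF cont\<phi>]
  define h where "h x = (\<integral>t. \<phi> t * g (x - t) \<partial>lborel)" for x
  have near: "\<phi> t * \<bar>g (x - t) - g x\<bar> \<le> \<phi> t * (L * r)" for x t
  proof (cases "norm t \<ge> r")
    case False
    have "\<bar>g (x - t) - g x\<bar> \<le> L * norm t"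
      using lipschitz_on_normD[OF L, of "x - t" x] by simp
    also have "\<dots> \<le> L * r"
      using False Lge by (intro mult_left_mono) auto
    finally show ?thesis using \<phi>(2) by (intro mult_left_mono)
  qed (simp add: \<phi>(3))
  have int: "integrable lborel (\<lambda>t. \<phi> t * g (x - t))" for x
  proof (rule Bochner_Integration.integrable_bound)
    show "integrable lborel (\<lambda>t. \<phi> t * (\<bar>g x\<bar> + L * r))" using \<phi>(4) by simp
    show "AE t in lborel. norm (\<phi> t * g (x - t)) \<le> norm (\<phi> t * (\<bar>g x\<bar> + L * r))"
    proof (intro always_eventually allI)
      fix t
      have "norm (\<phi> t * g (x - t)) \<le> \<phi> t * (\<bar>g x\<bar> + \<bar>g (x - t) - g x\<bar>)"
        using \<phi>(2)[of t] by (auto simp: abs_mult intro!: mult_left_mono)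
      also have "\<dots> \<le> \<phi> t * (\<bar>g x\<bar> + L * r)"
        using near[of t x] by (simp add: distrib_left)
      finally show "norm (\<phi> t * g (x - t)) \<le> norm (\<phi> t * (\<bar>g x\<bar> + L * r))" by simp
    qed
  qed simp
  \<comment> \<open>Comparing with \<open>v t = g (y - t)\<close> gives the Lipschitz bound, with \<open>v t = g x\<close> the distance to \<open>g\<close>.\<close>
  have avg: "\<bar>h x - (\<integral>t. \<phi> t * v t \<partial>lborel)\<bar> \<le> c"
    if v: "integrable lborel (\<lambda>t. \<phi> t * v t)" and le: "\<And>t. \<phi> t * \<bar>g (x - t) - v t\<bar> \<le> \<phi> t * c" for x v c
  proof -
    have "h x - (\<integral>t. \<phi> t * v t \<partial>lborel) = (\<integral>t. \<phi> t * (g (x - t) - v t) \<partial>lborel)"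
      using int v by (simp add: h_def right_diff_distrib)
    also have "\<bar>\<dots>\<bar> \<le> (\<integral>t. \<phi> t * c \<partial>lborel)"
      using \<phi>(2,4) le by (intro integral_abs_bound[THEN order_trans] integral_mono')
        (auto simp: abs_mult intro: order_trans[OF _ le])
    finally show ?thesis using \<phi>(5) by simp
  qed
  show thesis
  proof
    obtain a b where ab: "cball 0 R \<subseteq> cbox a (b::'a)"
      using bounded_subset_cbox_symmetric[OF bounded_cball, of 0 R] by blast
    have "h x = integral (cbox a b) (\<lambda>y. g y * \<phi> (x - y))" for x
    proof -
      have cont: "continuous_on (cbox a b) (\<lambda>y. g y * \<phi> (x - y))"
        by (intro continuous_intros continuous_on_compose2[OF contg] continuous_on_compose2[OF cont\<phi>]) auto
      have "h x = (\<integral>t. g (x - t) * \<phi> (x - (x - t)) \<partial>lborel)"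
        by (simp add: h_def mult.commute)
      also have "\<dots> = (\<integral>y. g y * \<phi> (x - y) \<partial>lborel)"
        by (rule lborel_integral_reflect[where h = "\<lambda>y. g y * \<phi> (x - y)"]) simp
      also have "\<dots> = (LINT y:cbox a b|lborel. g y * \<phi> (x - y))"
        unfolding set_lebesgue_integral_def
        using ab supp by (intro Bochner_Integration.integral_cong) (force simp: indicator_def)+
      also have "\<dots> = integral (cbox a b) (\<lambda>y. g y * \<phi> (x - y))"
        using borel_integrable_compact[OF compact_cbox cont]
        by (intro set_borel_integral_eq_integral) (simp add: set_integrable_def)
      finally show ?thesis .
    qed
    then have "h = (\<lambda>x. integral (cbox a b) (\<lambda>y. g y * \<phi> (x - y)))" by blast
    then show "smooth h"
      using cont_diff_convolution[OF contg] \<phi>(1) by (simp add: smooth_def)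
    show "h x = 0" if "norm x \<ge> R + r" for x
    proof -
      have "\<phi> t * g (x - t) = 0" for t
        using \<phi>(3)[of t] supp[of "x - t"] norm_triangle_ineq2[of x t] that by (cases "norm t \<ge> r") auto
      then show ?thesis by (simp only: h_def Bochner_Integration.integral_zero)
    qed
    show "L-lipschitz_on UNIV h"
    proof (rule lipschitz_onI)
      fix x y
      have "\<bar>h x - h y\<bar> \<le> L * dist x y"
        unfolding h_def[of y]
      proof (rule avg[OF int])
        show "\<phi> t * \<bar>g (x - t) - g (y - t)\<bar> \<le> \<phi> t * (L * dist x y)" for t
          using \<phi>(2) lipschitz_on_normD[OF L, of "x - t" "y - t"]
          by (intro mult_left_mono) (auto simp: dist_norm)
      qed
      then show "dist (h x) (h y) \<le> L * dist x y" by (simp add: dist_real_def)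
    qed (rule Lge)
    show "\<bar>h x - g x\<bar> \<le> L * r" for x
      using avg[OF _ near, of x] \<phi>(4,5) by simp
  qed
qed

lemma compactly_supportedI:
  fixes f :: "'a::euclidean_space \<Rightarrow> real"
  assumes "\<And>x. norm x \<ge> R \<Longrightarrow> f x = 0"
  shows "compactly_supported f"
proof -
  have "support_on UNIV f \<subseteq> cball 0 R"
    using assms by (force simp: support_on_def)
  then show ?thesis
    unfolding compactly_supported_def compact_closure using bounded_cball bounded_subset by blast
qed

text \<open>Multiplying \<open>f\<close> by a cutoff function would enlarge its Lipschitz constant. Clamping it between
  \<open>\<plusminus> c\<^sub>n\<close>, where \<open>c\<^sub>n x = max 0 (L (n - norm x))\<close> is itself \<open>L\<close>-Lipschitz, does not: minima and
  maxima of \<open>L\<close>-Lipschitz functions are \<open>L\<close>-Lipschitz. The normalisation \<open>f 0 = 0\<close> gives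
  \<open>\<bar>f x\<bar> \<le> L * norm x\<close>, so the clamp is inactive on the ball of radius \<open>n / 2\<close>. A final
  mollification at scale \<open>1 / (n + 1)\<close> makes the result smooth.\<close>

lemma lipschitz_approximation:
  fixes f :: "'a::euclidean_space \<Rightarrow> real"
  assumes L: "L-lipschitz_on UNIV f" and f0: "f 0 = 0"
  obtains F :: "nat \<Rightarrow> 'a \<Rightarrow> real" where
    "\<And>n. smooth (F n)" "\<And>n. compactly_supported (F n)" "\<And>n. L-lipschitz_on UNIV (F n)"
    "\<And>n x. \<bar>F n x\<bar> \<le> L * (norm x + 1)" "\<And>x. (\<lambda>n. F n x) \<longlonglongrightarrow> f x"
proof -
  have Lge: "L \<ge> 0" by (rule lipschitz_on_nonneg[OF L])
  have growth: "\<bar>f x\<bar> \<le> L * norm x" for x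
    using lipschitz_on_normD[OF L, of x 0] f0 by simp
  define c where "c n x = max 0 (L * (real n - norm x))" for n :: nat and x :: 'a
  define g where "g n x = max (- c n x) (min (c n x) (f x))" for n x
  have "L-lipschitz_on UNIV (\<lambda>x::'a. L * (real n - norm x))" for n
    using lipschitz_on_normD[OF lipschitz_on_norm] Lge
    by (intro lipschitz_onI) (auto simp: dist_norm norm_triangle_ineq3 abs_minus_commute
        abs_mult simp flip: right_diff_distrib intro!: mult_left_mono)
  then have "L-lipschitz_on UNIV (c n)" for n
    unfolding c_def using lipschitz_on_le[OF lipschitz_on_constant Lge] by (intro lipschitz_on_max) auto
  then have gL: "L-lipschitz_on UNIV (g n)" for n
    unfolding g_def using L by (intro lipschitz_on_max lipschitz_on_min) auto
  have g_supp: "g n x = 0" if "norm x \<ge> real n" for n x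
  proof -
    have "c n x = 0" using that Lge by (simp add: c_def max_absorb1 mult_nonneg_nonpos)
    then show ?thesis by (simp add: g_def)
  qed
  have g_le: "\<bar>g n x\<bar> \<le> \<bar>f x\<bar>" for n x
    by (auto simp: g_def c_def)
  have g_eq: "g n x = f x" if "real n \<ge> 2 * norm x" for n x
  proof -
    have "L * norm x \<le> L * (real n - norm x)" using that Lge by (intro mult_left_mono) auto
    then show ?thesis using growth[of x] by (auto simp: g_def c_def max_def min_def)
  qed
  have "\<exists>h. smooth h \<and> (\<forall>x. norm x \<ge> real n + 1 / Suc n \<longrightarrow> h x = 0) \<and>
    L-lipschitz_on UNIV h \<and> (\<forall>x. \<bar>h x - g n x\<bar> \<le> L * (1 / Suc n))" for n
    by (rule lipschitz_mollification[OF gL g_supp, of n n "1 / Suc n"]) auto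
  then obtain F where F: "smooth (F n)" "\<And>x. norm x \<ge> real n + 1 / Suc n \<Longrightarrow> F n x = 0"
    "L-lipschitz_on UNIV (F n)" "\<And>x. \<bar>F n x - g n x\<bar> \<le> L * (1 / Suc n)" for n
    by metis
  show thesis
  proof
    show "compactly_supported (F n)" for n
      using F(2) by (rule compactly_supportedI)
    show "\<bar>F n x\<bar> \<le> L * (norm x + 1)" for n x
    proof -
      have "L * (1 / Suc n) \<le> L * 1" using Lge by (intro mult_left_mono) auto
      then show ?thesis using F(4)[where n = n and x = x] g_le[of n x] growth[of x] by (simp add: distrib_left)
    qed
    show "(\<lambda>n. F n x) \<longlonglongrightarrow> f x" for x
    proof (rule LIM_zero_cancel, rule Lim_null_comparison)
      have "\<forall>\<^sub>F n in sequentially. 2 * norm x \<le> real n"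
        using filterlim_real_sequentially by (auto simp: filterlim_at_top)
      then show "\<forall>\<^sub>F n in sequentially. norm (F n x - f x) \<le> L * (1 / Suc n)"
      proof eventually_elim
        case (elim n)
        then show ?case using F(4)[where n = n and x = x] by (simp only: g_eq real_norm_def)
      qed
      show "(\<lambda>n. L * (1 / Suc n)) \<longlonglongrightarrow> 0"
        using tendsto_mult[OF tendsto_const[of L] LIMSEQ_Suc[OF lim_1_over_n]] by simp
    qed
  qed (use F in auto)
qed

section \<open>From smooth test functions to Lipschitz functions\<close>

lemma fatou_bounded:
  fixes u :: "nat \<Rightarrow> 'a \<Rightarrow> real"
  assumes int: "\<And>n. integrable M (u n)" and nonneg: "\<And>n x. 0 \<le> u n x"
    and lim: "\<And>x. (\<lambda>n. u n x) \<longlonglongrightarrow> v x" and bound: "\<And>n. (\<integral>x. u n x \<partial>M) \<le> C"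
  shows "integrable M v" "(\<integral>x. v x \<partial>M) \<le> C"
proof -
  have [measurable]: "u n \<in> borel_measurable M" for n
    using int by blast
  have [measurable]: "v \<in> borel_measurable M"
    by (rule borel_measurable_LIMSEQ_real[OF lim]) simp
  have v: "0 \<le> v x" for x
    by (rule LIMSEQ_le_const[OF lim]) (use nonneg in auto)
  have C: "0 \<le> C"
    by (rule order_trans[OF _ bound[of 0]]) (simp add: nonneg)
  have "(\<integral>\<^sup>+x. ennreal (v x) \<partial>M) = (\<integral>\<^sup>+x. liminf (\<lambda>n. ennreal (u n x)) \<partial>M)"
    by (intro nn_integral_cong lim_imp_Liminf[symmetric] tendsto_ennrealI lim) simp
  also have "\<dots> \<le> liminf (\<lambda>n. \<integral>\<^sup>+x. ennreal (u n x) \<partial>M)"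
    by (rule nn_integral_liminf) simp
  also have "\<dots> \<le> liminf (\<lambda>n::nat. ennreal C)"
    using int nonneg bound
    by (intro Liminf_mono always_eventually allI) (simp add: nn_integral_eq_integral ennreal_leI)
  also have "\<dots> = ennreal C" by (simp add: Liminf_const)
  finally have le: "(\<integral>\<^sup>+x. ennreal (v x) \<partial>M) \<le> ennreal C" .
  show "integrable M v"
    using le v by (intro integrableI_nonneg) (auto intro: le_less_trans)
  show "(\<integral>x. v x \<partial>M) \<le> C"
    using C le by (rule integral_real_bounded)
qed

text \<open>For a test function the concentration bound may be used with any Lipschitz constant \<open>L\<close> in
  place of \<^const>\<open>lip\<close>, and without the logarithm, which is the form that passes to limits.\<close>

lemma GCBS_lipschitz_bound:
  fixes \<mu> :: "('a::euclidean_space) measure"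
  assumes "prob_space \<mu>" and sets: "sets \<mu> = sets borel" and "D \<ge> 0" and "GCBS \<mu> D"
    and f: "smooth f" "compactly_supported f" and L: "L-lipschitz_on UNIV f"
  shows "integrable \<mu> f" "integrable \<mu> (\<lambda>x. exp (c * f x))"
    and "(\<integral>x. exp (f x - (\<integral>y. f y \<partial>\<mu>)) \<partial>\<mu>) \<le> exp (D * L\<^sup>2)"
proof -
  interpret prob_space \<mu> by fact
  have cont: "continuous_on UNIV f"
    by (rule lipschitz_on_continuous_on[OF L])
  have [measurable]: "f \<in> borel_measurable \<mu>"
    using borel_measurable_continuous_onI[OF cont] measurable_cong_sets[OF sets refl] by blast
  have "compact (f ` closure (support_on UNIV f))"
    using f(2) by (intro compact_continuous_image continuous_on_subset[OF cont])
      (auto simp: compactly_supported_def)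
  then obtain B where B: "\<And>x. x \<in> closure (support_on UNIV f) \<Longrightarrow> \<bar>f x\<bar> \<le> B"
    using compact_imp_bounded by (force simp: bounded_iff)
  have bound: "\<bar>f x\<bar> \<le> \<bar>B\<bar>" for x
  proof (cases "f x = 0")
    case False
    then have "x \<in> closure (support_on UNIV f)"
      using closure_subset by (force simp: support_on_def)
    then show ?thesis using B by fastforce
  qed simp
  show "integrable \<mu> f"
    by (rule integrable_const_bound[of _ "\<bar>B\<bar>"]) (auto simp: bound)
  show "integrable \<mu> (\<lambda>x. exp (c * f x))"
  proof (rule integrable_const_bound[of _ "exp (\<bar>c\<bar> * \<bar>B\<bar>)"])
    have "c * f x \<le> \<bar>c\<bar> * \<bar>B\<bar>" for x
    proof -
      have "c * f x \<le> \<bar>c\<bar> * \<bar>f x\<bar>" by (metis abs_ge_self abs_mult)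
      also have "\<dots> \<le> \<bar>c\<bar> * \<bar>B\<bar>" using bound by (intro mult_left_mono) auto
      finally show ?thesis .
    qed
    then show "AE x in \<mu>. norm (exp (c * f x)) \<le> exp (\<bar>c\<bar> * \<bar>B\<bar>)" by simp
  qed simp
  let ?I = "\<integral>x. exp (f x - (\<integral>y. f y \<partial>\<mu>)) \<partial>\<mu>"
  have "ln ?I \<le> D * (lip f)\<^sup>2"
    using \<open>GCBS \<mu> D\<close> f by (simp add: GCBS_def)
  also have "\<dots> \<le> D * L\<^sup>2"
    using lip_le[OF L] lip_nonneg[of f] L \<open>D \<ge> 0\<close>
    by (intro mult_left_mono power_mono) (auto simp: lipschitz_def)
  finally have "ln ?I \<le> D * L\<^sup>2" .
  then show "?I \<le> exp (D * L\<^sup>2)"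
    \<comment> \<open>If \<open>?I\<close> were not positive, the bound would be trivial, whatever the value of \<open>ln ?I\<close>.\<close>
    by (cases "?I > 0") (use exp_le_cancel_iff[of "ln ?I"] in \<open>auto simp: not_less intro: order_trans\<close>)
qed

text \<open>Take approximations \<open>F\<^sub>n\<close> of the norm with \<open>F\<^sub>n \<le> norm + 1\<close>. Their means stay bounded:
  the bound for \<open>- F\<^sub>n\<close> reads \<open>exp(\<mu>(F\<^sub>n)) \<mu>(exp(- F\<^sub>n)) \<le> exp D\<close>, and the second factor is at least
  the positive constant \<open>c = \<mu>(exp(- norm - 1))\<close>. Inserting this in the bound for \<open>F\<^sub>n\<close> itself
  bounds \<open>\<mu>(exp(F\<^sub>n))\<close> uniformly in \<open>n\<close>, and Fatou's lemma yields even \<open>\<mu>(exp(norm)) < \<infinity>\<close>.\<close>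

lemma GCBS_imp_integrable_norm:
  fixes \<mu> :: "('a::euclidean_space) measure"
  assumes "prob_space \<mu>" and sets: "sets \<mu> = sets borel" and "D \<ge> 0" and "GCBS \<mu> D"
  shows "integrable \<mu> norm"
proof -
  interpret prob_space \<mu> by fact
  have [measurable]: "norm \<in> borel_measurable \<mu>"
    using measurable_cong_sets[OF sets refl] borel_measurable_continuous_onI[OF continuous_on_norm_id]
    by blast
  obtain F :: "nat \<Rightarrow> 'a \<Rightarrow> real" where F: "\<And>n. smooth (F n)" "\<And>n. compactly_supported (F n)"
    "\<And>n. 1-lipschitz_on UNIV (F n)" "\<And>n x. \<bar>F n x\<bar> \<le> 1 * (norm x + 1)" "\<And>x. (\<lambda>n. F n x) \<longlonglongrightarrow> norm x"
    using lipschitz_approximation[OF lipschitz_on_norm] by auto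
  have "compactly_supported (\<lambda>x. - F n x)" for n
    using F(2) by (simp add: compactly_supported_def support_on_def)
  moreover have "smooth (\<lambda>x. - F n x)" for n
    using F(1)[of n] cont_diff_mult[OF cont_diff_const[of _ "-1"]] by (fastforce simp: smooth_def)
  moreover have "1-lipschitz_on UNIV (\<lambda>x. - F n x)" for n
    using F(3) by simp
  ultimately have neg: "(\<integral>x. exp (- F n x - (\<integral>y. - F n y \<partial>\<mu>)) \<partial>\<mu>) \<le> exp (D * 1\<^sup>2)" for n
    by (intro GCBS_lipschitz_bound[OF assms])
  have exp_int: "integrable \<mu> (\<lambda>x. exp (c * F n x))" for c n
    by (rule GCBS_lipschitz_bound[OF assms F(1-3)])
  define c where "c = (\<integral>x. exp (- norm x - 1) \<partial>\<mu>)"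
  have intc: "integrable \<mu> (\<lambda>x. exp (- norm x - 1))"
    by (rule integrable_const_bound[of _ 1]) (auto intro!: AE_I2 order_trans[OF _ norm_ge_zero])
  have "c > 0"
  proof -
    have "c \<noteq> 0"
    proof
      assume "c = 0"
      then have "AE x in \<mu>. exp (- norm x - 1) = 0"
        unfolding c_def by (subst (asm) integral_nonneg_eq_0_iff_AE[OF intc]) auto
      then show False by simp
    qed
    moreover have "c \<ge> 0" by (simp add: c_def)
    ultimately show ?thesis by simp
  qed
  have mean: "exp (\<integral>y. F n y \<partial>\<mu>) \<le> exp D / c" for n
  proof -
    have "c \<le> (\<integral>x. exp (- F n x) \<partial>\<mu>)"
      unfolding c_def
    proof (rule integral_mono[OF intc])
      show "integrable \<mu> (\<lambda>x. exp (- F n x))" using exp_int[of "-1" n] by simp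
      show "exp (- norm x - 1) \<le> exp (- F n x)" for x using F(4)[of n x] by auto
    qed
    then have "c * exp (\<integral>y. F n y \<partial>\<mu>) \<le> (\<integral>x. exp (- F n x) \<partial>\<mu>) * exp (\<integral>y. F n y \<partial>\<mu>)"
      by (intro mult_right_mono) auto
    also have "\<dots> = (\<integral>x. exp (- F n x - (\<integral>y. - F n y \<partial>\<mu>)) \<partial>\<mu>)"
    proof -
      have "exp (- F n x - (\<integral>y. - F n y \<partial>\<mu>)) = exp (- F n x) * exp (\<integral>y. F n y \<partial>\<mu>)" for x
        by (simp flip: exp_add)
      then show ?thesis by (simp only: integral_mult_left_zero)
    qed
    finally show ?thesis
      using neg[of n] \<open>c > 0\<close> by (simp add: field_simps)
  qed
  have bound: "(\<integral>x. exp (F n x) \<partial>\<mu>) \<le> exp D * (exp D / c)" for n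
  proof -
    have "(\<integral>x. exp (F n x) \<partial>\<mu>) = (\<integral>x. exp (F n x - (\<integral>y. F n y \<partial>\<mu>)) \<partial>\<mu>) * exp (\<integral>y. F n y \<partial>\<mu>)"
      by (simp add: exp_diff)
    also have "\<dots> \<le> exp D * (exp D / c)"
      using GCBS_lipschitz_bound(3)[OF assms F(1-3), of n] mean by (intro mult_mono) auto
    finally show ?thesis .
  qed
  have "integrable \<mu> (\<lambda>x. exp (norm x))"
  proof (rule fatou_bounded(1)[OF _ _ _ bound])
    show "integrable \<mu> (\<lambda>x. exp (F n x))" for n using exp_int[of 1 n] by simp
  qed (auto intro: tendsto_exp F)
  then show ?thesis
  proof (rule Bochner_Integration.integrable_bound)
    have "norm x \<le> exp (norm x)" for x :: 'a
      using exp_ge_add_one_self[of "norm x"] by linarith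
    then show "AE x in \<mu>. norm (norm x) \<le> norm (exp (norm x))" by simp
  qed simp
qed

text \<open>Subtracting \<open>f 0\<close> changes neither the Lipschitz constant nor the centred function
  \<open>f - \<mu>(f)\<close>, so the approximation lemma for functions vanishing at 0 suffices.\<close>

lemma GCBS_imp_GCB:
  fixes \<mu> :: "('a::euclidean_space) measure"
  assumes "prob_space \<mu>" and sets: "sets \<mu> = sets borel" and "D \<ge> 0" and "GCBS \<mu> D"
  shows "GCB \<mu> D"
  unfolding GCB_def
proof (intro allI impI)
  fix f :: "'a \<Rightarrow> real"
  assume "lipschitz f"
  interpret prob_space \<mu> by fact
  define L where "L = lip f"
  define g where "g x = f x - f 0" for x
  have "L-lipschitz_on UNIV f"
    unfolding L_def by (rule lipschitz_on_lip) fact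
  then have gL: "L-lipschitz_on UNIV g"
    using lipschitz_on_diff[OF _ lipschitz_on_constant] by (fastforce simp: g_def)
  obtain F where F: "\<And>n. smooth (F n)" "\<And>n. compactly_supported (F n)"
    "\<And>n. L-lipschitz_on UNIV (F n)" "\<And>n x. \<bar>F n x\<bar> \<le> L * (norm x + 1)" "\<And>x. (\<lambda>n. F n x) \<longlonglongrightarrow> g x"
    using lipschitz_approximation[OF gL] by (auto simp: g_def)
  note F_bound = GCBS_lipschitz_bound[OF assms F(1-3)]
  have [measurable]: "F n \<in> borel_measurable \<mu>" for n
    using F_bound(1) by blast
  have [measurable]: "g \<in> borel_measurable \<mu>"
    by (rule borel_measurable_LIMSEQ_real[OF F(5)]) simp
  have dom: "integrable \<mu> (\<lambda>x. L * (norm x + 1))"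
    using GCBS_imp_integrable_norm[OF assms] by simp
  have AE: "AE x in \<mu>. (\<lambda>n. F n x) \<longlonglongrightarrow> g x" "\<And>n. AE x in \<mu>. norm (F n x) \<le> L * (norm x + 1)"
    using F(4,5) by auto
  have intg: "integrable \<mu> g"
    by (rule integrable_dominated_convergence[OF _ _ dom AE]) auto
  have means: "(\<lambda>n. \<integral>x. F n x \<partial>\<mu>) \<longlonglongrightarrow> (\<integral>x. g x \<partial>\<mu>)"
    by (rule integral_dominated_convergence[OF _ _ dom AE]) auto
  have "integrable \<mu> (\<lambda>x. exp (1 * F n x))" for n
    by (rule F_bound)
  then have "integrable \<mu> (\<lambda>x. exp (F n x - (\<integral>y. F n y \<partial>\<mu>)))" for n
    by (simp add: exp_diff)
  note fatou = fatou_bounded[OF this _ _ F_bound(3), where v = "\<lambda>x. exp (g x - (\<integral>y. g y \<partial>\<mu>))"]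
  have exp_g: "integrable \<mu> (\<lambda>x. exp (g x - (\<integral>y. g y \<partial>\<mu>)))"
    "(\<integral>x. exp (g x - (\<integral>y. g y \<partial>\<mu>)) \<partial>\<mu>) \<le> exp (D * L\<^sup>2)"
    by (rule fatou; auto intro!: tendsto_exp tendsto_diff F means)+
  have intf: "integrable \<mu> f"
    using Bochner_Integration.integrable_add[OF intg integrable_const[of "f 0"]] by (simp add: g_def)
  then have centred: "f x - (\<integral>y. f y \<partial>\<mu>) = g x - (\<integral>y. g y \<partial>\<mu>)" for x
    by (simp add: g_def prob_space)
  \<comment> \<open>By \<open>1 + u \<le> exp u\<close> the exponential moment of a centred function is at least 1.\<close>
  have "(\<integral>x. exp (g x - (\<integral>y. g y \<partial>\<mu>)) \<partial>\<mu>) > 0"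
  proof -
    have "1 + (g x - (\<integral>y. g y \<partial>\<mu>)) \<le> exp (g x - (\<integral>y. g y \<partial>\<mu>))" for x
      by (rule exp_ge_add_one_self)
    then have "(\<integral>x. 1 + (g x - (\<integral>y. g y \<partial>\<mu>)) \<partial>\<mu>) \<le> (\<integral>x. exp (g x - (\<integral>y. g y \<partial>\<mu>)) \<partial>\<mu>)"
      using intg exp_g(1) by (intro integral_mono) auto
    then show ?thesis using intg by (simp add: prob_space)
  qed
  then have "ln (\<integral>x. exp (g x - (\<integral>y. g y \<partial>\<mu>)) \<partial>\<mu>) \<le> D * L\<^sup>2"
    using exp_g(2) exp_le_cancel_iff[of "ln (\<integral>x. exp (g x - (\<integral>y. g y \<partial>\<mu>)) \<partial>\<mu>)"] by simp
  then show "integrable \<mu> f \<and> integrable \<mu> (\<lambda>x. exp (f x - (\<integral>y. f y \<partial>\<mu>))) \<and>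
      ln (\<integral>x. exp (f x - (\<integral>y. f y \<partial>\<mu>)) \<partial>\<mu>) \<le> D * (lip f)\<^sup>2"
    using intf exp_g(1) by (simp add: centred L_def)
qed

theorem proposition2p1:
  fixes \<mu> :: "(real ^ 'd) measure" and D :: real
  assumes "prob_space \<mu>" and "sets \<mu> = sets borel"
    and "D \<ge> 0"
    and "GCBS \<mu> D"
  shows "GCB \<mu> D"
  using assms by (rule GCBS_imp_GCB)

end
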